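(* Suppose $x\in\mathcal{X}_{\mathrm{free}}$ and $\xi\in\mathcal{X}$, $\xi\neq0$, with $h_F(x,\xi)>0$. Then there exists $\rho^\star=\rho^\star(x)>0$ such that for all $\rho\in(0,\rho^\star)$ there exists $r(\rho)=r(\rho,x)>0$ with $$\mathcal{B}_{\rho^\star}(x)\setminus\mathcal{B}_\rho(x)\subset\big(B_{r(\rho)}(x)\big)^c.$$ Equivalently, if $y\in\mathcal{X}$ satisfies $\rho\le\min\{d_c(x,y),d_c(y,x)\}<\rho^\star$, then $\|x-y\|\ge r(\rho)$.
   Context: Setting. $\mathcal{X}\subseteq\mathbb{R}^n$ (state space) is a linear subspace with inner product $\langle\cdot,\cdot\rangle$ and norm $\|\cdot\|$; $B_r(x)=\{y\in\mathcal{X}:\|x-y\|<r\}$ and $(\cdot)^c$ is complement in $\mathcal{X}$. $F:\mathcal{X}\rightrightarrows\mathcal{X}$ is a set-valued map (the admissible velocities $F(x)=\{f(x,u):u\in\mathcal{U}\}$ of a control system) satisfying: (SH1) each $F(x)$ is nonempty and convex, the graph $\{(x,v):v\in F(x)\}$ is closed in $\mathcal{X}^2$, and for each compact $K\subset\mathcal{X}$ there is $M>0$ with $\|v\|\le M$ whenever $x\in K$, $v\in F(x)$; (SH2) there are $\gamma,c>0$ with $\|v\|\le\gamma\|x\|+c$ for all $x\in\mathcal{X}$, $v\in F(x)$; (SH3) for each compact $K\subset\mathcal{X}$ there is $k>0$ with $F(x)\subseteq F(y)+k\|x-y\|\overline{B_1(0)}$ for all $x,y\in K$. The minimal Hamiltonian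 is $h_F(x,\xi):=\inf_{v\in F(x)}\langle v,\xi\rangle$. The running cost $\psi:\mathcal{X}^2\to(0,\infty)$ is continuous. Obstacles and trajectories. $\mathcal{O}\subset\mathcal{X}$ is a closed set (obstacle), $\mathcal{X}_{\mathrm{free}}:=\mathcal{X}\setminus\mathcal{O}$. $\Pi(x,y)$ is the set of absolutely continuous $\pi:[0,T_\pi]\to\mathcal{X}$ (some $T_\pi\ge0$) with $\dot\pi(t)\in F(\pi(t))$ for a.e. $t$, $\pi(0)=x$, $\pi(T_\pi)=y$, and $\pi(t)\in\overline{\mathcal{X}_{\mathrm{free}}}$ for all $t\in[0,T_\pi]$. The cost of $\pi$ is $c_\pi:=\int_0^{T_\pi}\psi(\pi(t),\dot\pi(t))\,dt$. Derived notions. $d_c(x,y):=\inf\{c_\pi:\pi\in\Pi(x,y)\}$ ($=\infty$ if $\Pi(x,y)=\emptyset$); $\mathcal{F}_\rho(x):=\{y\in\mathcal{X}:d_c(x,y)<\rho\}$; $\mathcal{R}_\rho(x):=\{y\in\mathcal{X}:d_c(y,x)<\rho\}$; cost ball $\mathcal{B}_\rho(x):=\mathcal{F}_\rho(x)\cup\mathcal{R}_\rho(x)$. *)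

theory Defs
  imports "HOL-Analysis.Analysis"
begin

text \<open>
  The state space is a linear subspace \<open>X\<close> of a Euclidean space, with the restricted inner product.
  Set-valued maps and running costs are total functions on the ambient type; only their values on
  \<open>X\<close>, respectively \<open>X \<times> X\<close>, are constrained.
\<close>

definition SH1 :: "'a::euclidean_space set \<Rightarrow> ('a \<Rightarrow> 'a set) \<Rightarrow> bool" where
  "SH1 X F \<longleftrightarrow>
     (\<forall>x\<in>X. F x \<noteq> {} \<and> convex (F x)) \<and>
     closed {(x, v). x \<in> X \<and> v \<in> F x} \<and>
     (\<forall>K. compact K \<and> K \<subseteq> X \<longrightarrow> (\<exists>M>0. \<forall>x\<in>K. \<forall>v\<in>F x. norm v \<le> M))"

definition SH2 :: "'a::euclidean_space set \<Rightarrow> ('a \<Rightarrow> 'a set) \<Rightarrow> bool" where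
  "SH2 X F \<longleftrightarrow> (\<exists>\<gamma>>0. \<exists>c>0. \<forall>x\<in>X. \<forall>v\<in>F x. norm v \<le> \<gamma> * norm x + c)"

definition SH3 :: "'a::euclidean_space set \<Rightarrow> ('a \<Rightarrow> 'a set) \<Rightarrow> bool" where
  "SH3 X F \<longleftrightarrow>
     (\<forall>K. compact K \<and> K \<subseteq> X \<longrightarrow>
       (\<exists>k>0. \<forall>x\<in>K. \<forall>y\<in>K.
          F x \<subseteq> {v + (k * norm (x - y)) *\<^sub>R b | v b. v \<in> F y \<and> b \<in> X \<inter> cball 0 1}))"

text \<open>A real infimum; it is the true one when \<open>F x\<close> is nonempty and bounded, as under \<open>SH1\<close>.\<close>

definition min_hamiltonian :: "('a::euclidean_space \<Rightarrow> 'a set) \<Rightarrow> 'a \<Rightarrow> 'a \<Rightarrow> real" where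
  "min_hamiltonian F x \<xi> = (INF v\<in>F x. v \<bullet> \<xi>)"

definition absolutely_continuous_on_ivl :: "real \<Rightarrow> real \<Rightarrow> (real \<Rightarrow> 'a::real_normed_vector) \<Rightarrow> bool" where
  "absolutely_continuous_on_ivl s t f \<longleftrightarrow>
     (\<forall>\<epsilon>>0. \<exists>\<delta>>0. \<forall>(n::nat) a b.
        (\<forall>i<n. s \<le> a i \<and> a i \<le> b i \<and> b i \<le> t) \<and>
        disjoint_family_on (\<lambda>i. {a i<..<b i}) {..<n} \<and>
        (\<Sum>i<n. b i - a i) < \<delta> \<longrightarrow>
        (\<Sum>i<n. norm (f (b i) - f (a i))) < \<epsilon>)"

text \<open>
  A trajectory is a pair \<open>(T, p)\<close> of a duration and a function of which only the restriction to
  \<open>{0..T}\<close> matters. The closure below is taken in the ambient space; since a subspace is closed,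
  it is also the closure in \<open>X\<close>.
\<close>

definition trajectories ::
  "'a::euclidean_space set \<Rightarrow> ('a \<Rightarrow> 'a set) \<Rightarrow> 'a set \<Rightarrow> 'a \<Rightarrow> 'a \<Rightarrow> (real \<times> (real \<Rightarrow> 'a)) set" where
  "trajectories X F Obs x y =
     {(T, p). 0 \<le> T \<and> (\<forall>t\<in>{0..T}. p t \<in> X) \<and>
        absolutely_continuous_on_ivl 0 T p \<and>
        (AE t in lebesgue_on {0..T}. \<exists>v\<in>F (p t). (p has_vector_derivative v) (at t within {0..T})) \<and>
        p 0 = x \<and> p T = y \<and>
        (\<forall>t\<in>{0..T}. p t \<in> closure (X - Obs))}"

text \<open>
  The cost is the integral of a nonnegative function. Where \<open>p\<close> is not differentiable, the value of
  \<open>vector_derivative\<close> is arbitrary, but this concerns only a null set for trajectories.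
\<close>

definition path_cost :: "('a::euclidean_space \<Rightarrow> 'a \<Rightarrow> real) \<Rightarrow> real \<Rightarrow> (real \<Rightarrow> 'a) \<Rightarrow> ennreal" where
  "path_cost \<psi> T p =
     (\<integral>\<^sup>+ t. ennreal (\<psi> (p t) (vector_derivative p (at t within {0..T}))) \<partial>lebesgue_on {0..T})"

text \<open>The infimum in \<open>ennreal\<close> over the empty set is \<open>\<infinity>\<close>.\<close>

definition cost_dist ::
  "'a::euclidean_space set \<Rightarrow> ('a \<Rightarrow> 'a set) \<Rightarrow> 'a set \<Rightarrow> ('a \<Rightarrow> 'a \<Rightarrow> real) \<Rightarrow> 'a \<Rightarrow> 'a \<Rightarrow> ennreal" where
  "cost_dist X F Obs \<psi> x y = (INF (T, p)\<in>trajectories X F Obs x y. path_cost \<psi> T p)"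

definition forward_reach ::
  "'a::euclidean_space set \<Rightarrow> ('a \<Rightarrow> 'a set) \<Rightarrow> 'a set \<Rightarrow> ('a \<Rightarrow> 'a \<Rightarrow> real) \<Rightarrow> real \<Rightarrow> 'a \<Rightarrow> 'a set" where
  "forward_reach X F Obs \<psi> \<rho> x = {y \<in> X. cost_dist X F Obs \<psi> x y < ennreal \<rho>}"

definition backward_reach ::
  "'a::euclidean_space set \<Rightarrow> ('a \<Rightarrow> 'a set) \<Rightarrow> 'a set \<Rightarrow> ('a \<Rightarrow> 'a \<Rightarrow> real) \<Rightarrow> real \<Rightarrow> 'a \<Rightarrow> 'a set" where
  "backward_reach X F Obs \<psi> \<rho> x = {y \<in> X. cost_dist X F Obs \<psi> y x < ennreal \<rho>}"

definition cost_ball ::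
  "'a::euclidean_space set \<Rightarrow> ('a \<Rightarrow> 'a set) \<Rightarrow> 'a set \<Rightarrow> ('a \<Rightarrow> 'a \<Rightarrow> real) \<Rightarrow> real \<Rightarrow> 'a \<Rightarrow> 'a set" where
  "cost_ball X F Obs \<psi> \<rho> x = forward_reach X F Obs \<psi> \<rho> x \<union> backward_reach X F Obs \<psi> \<rho> x"

end

theory Submission
  imports Defs
begin

text \<open>
  By (SH1), (SH3) and continuity of \<open>\<psi>\<close> there is a small ball around \<open>x\<close> on which admissible
  velocities satisfy \<open>norm v \<le> M\<close> and \<open>h \<le> v \<bullet> \<xi>\<close> with \<open>h > 0\<close>, and on which the running cost lies in
  \<open>[m, C]\<close> with \<open>m > 0\<close>. A trajectory starting or ending at \<open>x\<close> that leaves the ball of radius \<open>\<delta>\<close>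
  needs time \<open>\<delta> / M\<close> inside it, hence costs at least \<open>m * \<delta> / M\<close>; this is the choice of the threshold
  radius. A cheaper trajectory of cost at least \<open>\<rho>\<close> stays in the ball, so it lasts at least \<open>\<rho> / C\<close>
  and drifts by at least \<open>h * \<rho> / C\<close> in direction \<open>\<xi>\<close>, which bounds the distance of its endpoints below.
\<close>

section \<open>Absolutely continuous functions on an interval\<close>

lemma absolutely_continuous_on_ivlE:
  assumes "absolutely_continuous_on_ivl s t f" "\<epsilon> > 0"
  obtains \<delta> where "\<delta> > 0"
    "\<And>(n::nat) a b. (\<forall>i<n. s \<le> a i \<and> a i \<le> b i \<and> b i \<le> t) \<Longrightarrow>
        disjoint_family_on (\<lambda>i. {a i<..<b i}) {..<n} \<Longrightarrow>
        (\<Sum>i<n. b i - a i) < \<delta> \<Longrightarrow> (\<Sum>i<n. norm (f (b i) - f (a i))) < \<epsilon>"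
proof -
  obtain \<delta> where \<delta>: "\<delta> > 0 \<and> (\<forall>(n::nat) a b. (\<forall>i<n. s \<le> a i \<and> a i \<le> b i \<and> b i \<le> t) \<and>
        disjoint_family_on (\<lambda>i. {a i<..<b i}) {..<n} \<and>
        (\<Sum>i<n. b i - a i) < \<delta> \<longrightarrow> (\<Sum>i<n. norm (f (b i) - f (a i))) < \<epsilon>)"
    using assms(1)[unfolded absolutely_continuous_on_ivl_def, THEN spec, THEN mp, OF assms(2)]
    by (rule exE) (rule that)
  show thesis
    by (rule that[OF conjunct1[OF \<delta>]],
        rule conjunct2[OF \<delta>, THEN spec, THEN spec, THEN spec, THEN mp]) (intro conjI)
qed

text \<open>The definition enumerates intervals by natural numbers, while a tagged division is a
  finite set without an order. A bijection from an initial segment of the naturals carries the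
  estimate over to such index sets.\<close>

lemma absolutely_continuous_on_ivl_finite_family:
  fixes f :: "real \<Rightarrow> 'b::real_normed_vector"
  assumes "absolutely_continuous_on_ivl s t f" "\<epsilon> > 0"
  obtains \<delta> where "\<delta> > 0"
    "\<And>(S::'i set) u v. finite S \<Longrightarrow> (\<forall>i\<in>S. s \<le> u i \<and> u i \<le> v i \<and> v i \<le> t) \<Longrightarrow>
       disjoint_family_on (\<lambda>i. {u i<..<v i}) S \<Longrightarrow> (\<Sum>i\<in>S. v i - u i) < \<delta> \<Longrightarrow>
       (\<Sum>i\<in>S. norm (f (v i) - f (u i))) < \<epsilon>"
proof -
  obtain \<delta> where "\<delta> > 0" and \<delta>: "\<And>(n::nat) a b. (\<forall>i<n. s \<le> a i \<and> a i \<le> b i \<and> b i \<le> t) \<Longrightarrow>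
        disjoint_family_on (\<lambda>i. {a i<..<b i}) {..<n} \<Longrightarrow>
        (\<Sum>i<n. b i - a i) < \<delta> \<Longrightarrow> (\<Sum>i<n. norm (f (b i) - f (a i))) < \<epsilon>"
    by (rule absolutely_continuous_on_ivlE[OF assms]) (rule that)
  have "(\<Sum>i\<in>S. norm (f (v i) - f (u i))) < \<epsilon>"
    if fin: "finite S" and uv: "\<forall>i\<in>S. s \<le> u i \<and> u i \<le> v i \<and> v i \<le> t"
      and disj: "disjoint_family_on (\<lambda>i. {u i<..<v i}) S" and len: "(\<Sum>i\<in>S. v i - u i) < \<delta>"
    for S :: "'i set" and u v
  proof -
    obtain g where g: "bij_betw g {..<card S} S"
      using ex_bij_betw_nat_finite[OF fin] by (auto simp: atLeast0LessThan)
    then have gS: "g i \<in> S" if "i < card S" for i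
      using that by (auto simp: bij_betw_def)
    have "(\<Sum>i<card S. norm (f (v (g i)) - f (u (g i)))) < \<epsilon>"
    proof (rule \<delta>)
      show "\<forall>i<card S. s \<le> u (g i) \<and> u (g i) \<le> v (g i) \<and> v (g i) \<le> t"
        using uv gS by blast
      show "disjoint_family_on (\<lambda>i. {u (g i)<..<v (g i)}) {..<card S}"
        unfolding disjoint_family_on_def
      proof (intro ballI impI)
        fix i j assume "i \<in> {..<card S}" "j \<in> {..<card S}" "i \<noteq> j"
        then have "g i \<noteq> g j" "g i \<in> S" "g j \<in> S"
          using g gS by (auto simp: bij_betw_def inj_on_def)
        then show "{u (g i)<..<v (g i)} \<inter> {u (g j)<..<v (g j)} = {}"
          using disj unfolding disjoint_family_on_def by blast
      qed
      show "(\<Sum>i<card S. v (g i) - u (g i)) < \<delta>"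
        using len sum.reindex_bij_betw[OF g, of "\<lambda>i. v i - u i"] by simp
    qed
    then show ?thesis
      using sum.reindex_bij_betw[OF g, of "\<lambda>i. norm (f (v i) - f (u i))"] by simp
  qed
  then show thesis by (rule that[OF \<open>\<delta> > 0\<close>])
qed

lemma absolutely_continuous_on_ivl_subset:
  assumes "absolutely_continuous_on_ivl s t f" "s \<le> s'" "t' \<le> t"
  shows "absolutely_continuous_on_ivl s' t' f"
  unfolding absolutely_continuous_on_ivl_def
proof (intro allI impI)
  fix \<epsilon> :: real assume "\<epsilon> > 0"
  then obtain \<delta> where "\<delta> > 0" and \<delta>: "\<And>(n::nat) a b. (\<forall>i<n. s \<le> a i \<and> a i \<le> b i \<and> b i \<le> t) \<Longrightarrow>
        disjoint_family_on (\<lambda>i. {a i<..<b i}) {..<n} \<Longrightarrow>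
        (\<Sum>i<n. b i - a i) < \<delta> \<Longrightarrow> (\<Sum>i<n. norm (f (b i) - f (a i))) < \<epsilon>"
    by (rule absolutely_continuous_on_ivlE[OF assms(1)]) (rule that)
  show "\<exists>\<delta>>0. \<forall>(n::nat) a b. (\<forall>i<n. s' \<le> a i \<and> a i \<le> b i \<and> b i \<le> t') \<and>
        disjoint_family_on (\<lambda>i. {a i<..<b i}) {..<n} \<and> (\<Sum>i<n. b i - a i) < \<delta> \<longrightarrow>
        (\<Sum>i<n. norm (f (b i) - f (a i))) < \<epsilon>"
    using \<open>\<delta> > 0\<close> assms(2,3) by (intro exI[of _ \<delta>] conjI allI impI \<delta>) force+
qed

text \<open>Half of \<open>\<epsilon>\<close> is allotted to the increments of \<open>f\<close> and
  half to the total length. This passes absolute continuity from a trajectory to a scalar component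
  corrected by a linear function of time.\<close>

lemma absolutely_continuous_on_ivl_dominated:
  fixes f :: "real \<Rightarrow> 'b::real_normed_vector" and g :: "real \<Rightarrow> 'c::real_normed_vector"
  assumes f: "absolutely_continuous_on_ivl s t f" and "A \<ge> 0" "B \<ge> 0"
    and dom: "\<And>a b. s \<le> a \<Longrightarrow> a \<le> b \<Longrightarrow> b \<le> t \<Longrightarrow>
                norm (g b - g a) \<le> A * norm (f b - f a) + B * (b - a)"
  shows "absolutely_continuous_on_ivl s t g"
  unfolding absolutely_continuous_on_ivl_def
proof (intro allI impI)
  fix \<epsilon> :: real assume \<epsilon>: "\<epsilon> > 0"
  \<comment> \<open>The summand \<open>+ 1\<close>, here and in \<open>\<delta>'\<close>, keeps the
    denominator positive when \<open>A\<close> or \<open>B\<close> vanishes; for \<open>B\<close> it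
    also makes the bound strict.\<close>
  define \<epsilon>' where "\<epsilon>' = \<epsilon> / (2 * (A + 1))"
  have "\<epsilon>' > 0" using \<epsilon> \<open>A \<ge> 0\<close> by (simp add: \<epsilon>'_def)
  then obtain \<delta> where "\<delta> > 0" and \<delta>: "\<And>(n::nat) a b. (\<forall>i<n. s \<le> a i \<and> a i \<le> b i \<and> b i \<le> t) \<Longrightarrow>
        disjoint_family_on (\<lambda>i. {a i<..<b i}) {..<n} \<Longrightarrow>
        (\<Sum>i<n. b i - a i) < \<delta> \<Longrightarrow> (\<Sum>i<n. norm (f (b i) - f (a i))) < \<epsilon>'"
    by (rule absolutely_continuous_on_ivlE[OF f]) (rule that)
  define \<delta>' where "\<delta>' = min \<delta> (\<epsilon> / (2 * (B + 1)))"
  have "\<delta>' > 0" using \<epsilon> \<open>B \<ge> 0\<close> \<open>\<delta> > 0\<close> by (simp add: \<delta>'_def)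
  have A: "A * \<epsilon>' \<le> \<epsilon> / 2" and B: "B * \<delta>' < \<epsilon> / 2"
  proof -
    show "A * \<epsilon>' \<le> \<epsilon> / 2" using \<epsilon> \<open>A \<ge> 0\<close> by (simp add: \<epsilon>'_def field_simps)
    have "B * \<delta>' \<le> B * (\<epsilon> / (2 * (B + 1)))"
      using \<open>B \<ge> 0\<close> by (intro mult_left_mono) (auto simp: \<delta>'_def)
    also have "\<dots> < \<epsilon> / 2" using \<epsilon> \<open>B \<ge> 0\<close> by (simp add: field_simps)
    finally show "B * \<delta>' < \<epsilon> / 2" .
  qed
  have "(\<Sum>i<n. norm (g (b i) - g (a i))) < \<epsilon>"
    if ab: "\<forall>i<n. s \<le> a i \<and> a i \<le> b i \<and> b i \<le> t"
      and disj: "disjoint_family_on (\<lambda>i. {a i<..<b i}) {..<n}" and len: "(\<Sum>i<n. b i - a i) < \<delta>'"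
    for n :: nat and a b
  proof -
    have "(\<Sum>i<n. norm (g (b i) - g (a i)))
          \<le> (\<Sum>i<n. A * norm (f (b i) - f (a i)) + B * (b i - a i))"
      using ab by (intro sum_mono dom) auto
    also have "\<dots> = A * (\<Sum>i<n. norm (f (b i) - f (a i))) + B * (\<Sum>i<n. b i - a i)"
      by (simp add: sum.distrib sum_distrib_left)
    also have "\<dots> \<le> A * \<epsilon>' + B * \<delta>'"
      using \<delta>[OF ab disj] len \<open>A \<ge> 0\<close> \<open>B \<ge> 0\<close>
      by (intro add_mono mult_left_mono) (auto simp: \<delta>'_def)
    also have "\<dots> < \<epsilon>" using A B by linarith
    finally show ?thesis .
  qed
  note small = this
  show "\<exists>\<delta>>0. \<forall>(n::nat) a b. (\<forall>i<n. s \<le> a i \<and> a i \<le> b i \<and> b i \<le> t) \<and>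
        disjoint_family_on (\<lambda>i. {a i<..<b i}) {..<n} \<and> (\<Sum>i<n. b i - a i) < \<delta> \<longrightarrow>
        (\<Sum>i<n. norm (g (b i) - g (a i))) < \<epsilon>"
    using \<open>\<delta>' > 0\<close> by (intro exI[of _ \<delta>'] conjI allI impI small) force+
qed

lemma absolutely_continuous_on_ivl_imp_continuous_on:
  fixes f :: "real \<Rightarrow> 'b::real_normed_vector"
  assumes "absolutely_continuous_on_ivl s t f"
  shows "continuous_on {s..t} f"
  unfolding continuous_on_iff
proof (intro ballI allI impI)
  fix x \<epsilon> :: real assume x: "x \<in> {s..t}" and "\<epsilon> > 0"
  obtain \<delta> where "\<delta> > 0" and \<delta>: "\<And>(S::unit set) u v. finite S \<Longrightarrow>
      (\<forall>i\<in>S. s \<le> u i \<and> u i \<le> v i \<and> v i \<le> t) \<Longrightarrow>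
      disjoint_family_on (\<lambda>i. {u i<..<v i}) S \<Longrightarrow> (\<Sum>i\<in>S. v i - u i) < \<delta> \<Longrightarrow>
      (\<Sum>i\<in>S. norm (f (v i) - f (u i))) < \<epsilon>"
    by (rule absolutely_continuous_on_ivl_finite_family[OF assms \<open>\<epsilon> > 0\<close>]) (rule that)
  have *: "norm (f v - f u) < \<epsilon>" if "s \<le> u" "u \<le> v" "v \<le> t" "v - u < \<delta>" for u v
    using \<delta>[of "{()}" "\<lambda>_. u" "\<lambda>_. v"] that by (auto simp: disjoint_family_on_def)
  show "\<exists>d>0. \<forall>x'\<in>{s..t}. dist x' x < d \<longrightarrow> dist (f x') (f x) < \<epsilon>"
  proof (intro exI[of _ \<delta>] conjI ballI impI)
    fix y assume "y \<in> {s..t}" "dist y x < \<delta>"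
    then show "dist (f y) (f x) < \<epsilon>"
      using *[of x y] *[of y x] x
      by (cases "x \<le> y") (auto simp: dist_norm norm_minus_commute)
  qed (rule \<open>\<delta> > 0\<close>)
qed

text \<open>An interval has the same measure as its interior, and different members of a tagged
  division have disjoint interiors. The sum is therefore the measure of a union lying inside
  \<open>U\<close>.\<close>

lemma tagged_division_content_le:
  fixes p :: "(real \<times> real set) set"
  assumes p: "p tagged_division_of {a..b}" and "S \<subseteq> p" "U \<in> lmeasurable"
    and sub: "\<And>x K. (x, K) \<in> S \<Longrightarrow> K \<subseteq> U"
  shows "(\<Sum>(x, K)\<in>S. measure lebesgue K) \<le> measure lebesgue U"
proof -
  have fin: "finite S" using p \<open>S \<subseteq> p\<close> by (meson finite_subset tagged_division_ofD(1))
  have K: "\<exists>u v. K = cbox u v" if "(x, K) \<in> S" for x K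
    using tagged_division_ofD(4)[OF p] that \<open>S \<subseteq> p\<close> by blast
  have meas: "interior K \<in> lmeasurable" "measure lebesgue (interior K) = measure lebesgue K"
    if xK: "(x, K) \<in> S" for x K
    using K[OF xK] by (auto simp: measure_lborel_box_eq measure_lborel_cbox_eq)
  have "(\<Sum>(x, K)\<in>S. measure lebesgue K) = (\<Sum>z\<in>S. measure lebesgue (interior (snd z)))"
    using meas(2) by (intro sum.cong) auto
  also have "\<dots> = measure lebesgue (\<Union>z\<in>S. interior (snd z))"
  proof (rule measure_negligible_finite_Union_image[symmetric, OF fin])
    show "interior (snd z) \<in> lmeasurable" if "z \<in> S" for z
      using meas(1) that by (cases z) auto
    show "pairwise (\<lambda>x y. negligible (interior (snd x) \<inter> interior (snd y))) S"
      unfolding pairwise_def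
    proof (intro ballI impI)
      fix y z assume "y \<in> S" "z \<in> S" "y \<noteq> z"
      then have "interior (snd y) \<inter> interior (snd z) = {}"
        using tagged_division_ofD(5)[OF p, of "fst y" "snd y" "fst z" "snd z"] \<open>S \<subseteq> p\<close>
        by auto
      then show "negligible (interior (snd y) \<inter> interior (snd z))" by simp
    qed
  qed
  also have "\<dots> \<le> measure lebesgue U"
  proof (rule measure_mono_fmeasurable)
    show "(\<Union>z\<in>S. interior (snd z)) \<subseteq> U"
    proof
      fix w assume "w \<in> (\<Union>z\<in>S. interior (snd z))"
      then obtain x K where "(x, K) \<in> S" "w \<in> interior K" by auto
      then show "w \<in> U" using sub interior_subset by blast
    qed
    show "(\<Union>z\<in>S. interior (snd z)) \<in> sets lebesgue"
      using fin meas(1) by (intro sets.finite_UN) (auto intro!: fmeasurableD)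
  qed (rule \<open>U \<in> lmeasurable\<close>)
  finally show ?thesis .
qed

text \<open>Both endpoints are compared with the tangent line at \<open>x\<close>. As
  \<open>u\<close> and \<open>v\<close> lie on opposite sides of \<open>x\<close>, the two errors
  add up to exactly \<open>\<epsilon> * (v - u)\<close>, and the slope contributes the nonnegative
  term \<open>d * (v - u)\<close>.\<close>

lemma has_real_derivative_nonneg_straddle:
  fixes f :: "real \<Rightarrow> real"
  assumes "(f has_real_derivative d) (at x within S)" "d \<ge> 0" "\<epsilon> > 0"
  obtains r where "r > 0" "\<And>u v. u \<in> S \<Longrightarrow> v \<in> S \<Longrightarrow> u \<in> ball x r \<Longrightarrow> v \<in> ball x r \<Longrightarrow>
      u \<le> x \<Longrightarrow> x \<le> v \<Longrightarrow> - \<epsilon> * (v - u) \<le> f v - f u"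
proof -
  have "(f has_derivative (*) d) (at x within S)"
    using assms(1) by (simp add: has_field_derivative_def)
  then obtain r where "r > 0" and
    r: "\<And>y. y \<in> S \<Longrightarrow> norm (y - x) < r \<Longrightarrow> norm (f y - f x - d * (y - x)) \<le> \<epsilon> * norm (y - x)"
    using \<open>\<epsilon> > 0\<close> unfolding has_derivative_within_alt by metis
  have "- \<epsilon> * (v - u) \<le> f v - f u"
    if "u \<in> S" "v \<in> S" "u \<in> ball x r" "v \<in> ball x r" "u \<le> x" "x \<le> v" for u v
  proof -
    have "\<bar>f u - f x - d * (u - x)\<bar> \<le> \<epsilon> * (x - u)" "\<bar>f v - f x - d * (v - x)\<bar> \<le> \<epsilon> * (v - x)"
      using r[of u] r[of v] that by (auto simp: dist_real_def)
    then have "d * (v - x) - d * (u - x) - \<epsilon> * (x - u) - \<epsilon> * (v - x) \<le> f v - f u"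
      by linarith
    moreover have "d * (v - x) - d * (u - x) = d * (v - u)" by (simp add: algebra_simps)
    moreover have "\<epsilon> * (x - u) + \<epsilon> * (v - x) = \<epsilon> * (v - u)" by (simp add: algebra_simps)
    moreover have "0 \<le> d * (v - u)" using that \<open>d \<ge> 0\<close> by simp
    ultimately show ?thesis by linarith
  qed
  with \<open>r > 0\<close> that show thesis by blast
qed

text \<open>
  Cousin's lemma replaces the usual Vitali covering argument: subintervals of a fine tagged division
  whose tags lie in the null set have small total length, so absolute continuity controls them; on
  the others the derivative does.
\<close>

lemma absolutely_continuous_on_ivl_nondecreasing:
  fixes f :: "real \<Rightarrow> real"
  assumes "a \<le> b" and ac: "absolutely_continuous_on_ivl a b f" and N: "negligible N"
    and der: "\<And>t. t \<in> {a..b} - N \<Longrightarrow> \<exists>d\<ge>0. (f has_real_derivative d) (at t within {a..b})"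
  shows "f a \<le> f b"
proof -
  \<comment> \<open>Of the slack, \<open>b - a\<close> is spent on the intervals tagged outside
    \<open>N\<close> and \<open>1\<close> on those tagged in \<open>N\<close>.\<close>
  have key: "- \<epsilon> * (b - a + 1) \<le> f b - f a" if \<epsilon>: "\<epsilon> > 0" for \<epsilon>
  proof -
    obtain \<delta> where "\<delta> > 0" and \<delta>: "\<And>(S::(real \<times> real set) set) u v. finite S \<Longrightarrow>
       (\<forall>i\<in>S. a \<le> u i \<and> u i \<le> v i \<and> v i \<le> b) \<Longrightarrow>
       disjoint_family_on (\<lambda>i. {u i<..<v i}) S \<Longrightarrow> (\<Sum>i\<in>S. v i - u i) < \<delta> \<Longrightarrow>
       (\<Sum>i\<in>S. norm (f (v i) - f (u i))) < \<epsilon>"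
      by (rule absolutely_continuous_on_ivl_finite_family[OF ac \<epsilon>]) (rule that)
    have "N \<in> sets lebesgue" using N by (simp add: negligible_imp_sets)
    \<comment> \<open>Outer regularity: since \<open>N\<close> is null, the whole open set
      \<open>U\<close> can be made smaller in measure than the \<open>\<delta>\<close> of absolute
      continuity.\<close>
    then obtain U where "open U" "N \<subseteq> U" and UN: "U - N \<in> lmeasurable"
      "emeasure lebesgue (U - N) < ennreal \<delta>"
      using sets_lebesgue_outer_open[OF _ \<open>\<delta> > 0\<close>] by metis
    have U_eq: "U = (U - N) \<union> N" using \<open>N \<subseteq> U\<close> by blast
    have Um: "U \<in> lmeasurable"
      by (subst U_eq) (intro fmeasurable.Un UN negligible_imp_measurable N)
    have "emeasure lebesgue (U - N) = ennreal (measure lebesgue (U - N))"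
      using UN(1) by (simp add: emeasure_eq_measure2)
    then have "measure lebesgue (U - N) < \<delta>"
      using UN(2) by (simp add: ennreal_less_iff)
    moreover have "measure lebesgue (U - N) = measure lebesgue U"
      using N \<open>open U\<close> by (simp add: measure_Diff_null_set negligible_iff_null_sets Um fmeasurableD)
    ultimately have Ud: "measure lebesgue U < \<delta>" by simp
    \<comment> \<open>The gauge confines intervals tagged in \<open>N\<close> to \<open>U\<close>
      and gives the straddle estimate at the other tags in \<open>{a..b}\<close>. Points outside
      \<open>{a..b}\<close> never serve as tags, so any radius will do there.\<close>
    have "\<exists>r>0. (x \<in> N \<longrightarrow> ball x r \<subseteq> U) \<and> (x \<in> {a..b} - N \<longrightarrow> (\<forall>u v. u \<in> {a..b} \<longrightarrow> v \<in> {a..b} \<longrightarrow>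
        u \<in> ball x r \<longrightarrow> v \<in> ball x r \<longrightarrow> u \<le> x \<longrightarrow> x \<le> v \<longrightarrow> - \<epsilon> * (v - u) \<le> f v - f u))" for x
    proof -
      consider "x \<in> N" | "x \<in> {a..b} - N" | "x \<notin> N" "x \<notin> {a..b}" by blast
      then show ?thesis
      proof cases
        case 1
        then show ?thesis using \<open>open U\<close> \<open>N \<subseteq> U\<close> by (metis DiffD2 open_contains_ball subsetD)
      next
        case 2
        then obtain d where "d \<ge> 0" "(f has_real_derivative d) (at x within {a..b})"
          using der by blast
        from has_real_derivative_nonneg_straddle[OF this(2,1) \<epsilon>] 2 show ?thesis
          by (metis DiffD2)
      next
        case 3
        then show ?thesis using zero_less_one by blast
      qed
    qed
    then obtain r where r0: "\<And>x. r x > 0" and rN: "\<And>x. x \<in> N \<Longrightarrow> ball x (r x) \<subseteq> U"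
      and r: "\<And>x u v. x \<in> {a..b} - N \<Longrightarrow> u \<in> {a..b} \<Longrightarrow> v \<in> {a..b} \<Longrightarrow> u \<in> ball x (r x) \<Longrightarrow>
                 v \<in> ball x (r x) \<Longrightarrow> u \<le> x \<Longrightarrow> x \<le> v \<Longrightarrow> - \<epsilon> * (v - u) \<le> f v - f u"
      by metis
    have "gauge (\<lambda>x. ball x (r x))" using r0 by (simp add: gauge_def)
    then obtain p where p: "p tagged_division_of {a..b}" and fine: "(\<lambda>x. ball x (r x)) fine p"
      using fine_division_exists_real by blast
    have fin: "finite p" using p by blast
    have ivl: "K = {Inf K..Sup K}" "Inf K \<le> x" "x \<le> Sup K" "a \<le> Inf K" "Sup K \<le> b"
         "K \<subseteq> ball x (r x)" "measure lebesgue K = Sup K - Inf K"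
      if xK: "(x, K) \<in> p" for x K
    proof -
      obtain u v where K: "K = {u..v}" using tagged_division_ofD(4)[OF p xK] by auto
      have "x \<in> K" "K \<subseteq> {a..b}" using tagged_division_ofD(2,3)[OF p xK] by auto
      with K show "K = {Inf K..Sup K}" "Inf K \<le> x" "x \<le> Sup K" "a \<le> Inf K" "Sup K \<le> b"
        "measure lebesgue K = Sup K - Inf K" by auto
      show "K \<subseteq> ball x (r x)" using fine xK by (auto simp: fine_def)
    qed
    \<comment> \<open>The increments of \<open>f\<close> over the division telescope to
      \<open>f b - f a\<close>; this sum is split according to whether the tag lies in
      \<open>N\<close>.\<close>
    define P where "P = {z \<in> p. fst z \<in> N}"
    let ?\<Delta> = "\<lambda>z::real \<times> real set. f (Sup (snd z)) - f (Inf (snd z))"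
    let ?len = "\<lambda>z::real \<times> real set. Sup (snd z) - Inf (snd z)"
    have "(\<Sum>z\<in>P. ?len z) = (\<Sum>(x, K)\<in>P. measure lebesgue K)"
      using ivl(7) by (intro sum.cong) (auto simp: P_def)
    also have "\<dots> \<le> measure lebesgue U"
      using ivl(6) rN by (intro tagged_division_content_le[OF p _ Um]) (force simp: P_def)+
    finally have "(\<Sum>z\<in>P. ?len z) < \<delta>" using Ud by simp
    then have "(\<Sum>z\<in>P. norm (?\<Delta> z)) < \<epsilon>"
    proof (rule \<delta>[rotated 3])
      show "disjoint_family_on (\<lambda>z. {Inf (snd z)<..<Sup (snd z)}) P"
        unfolding disjoint_family_on_def
      proof (intro ballI impI)
        fix y z assume yz: "y \<in> P" "z \<in> P" "y \<noteq> z"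
        have "interior (snd w) = {Inf (snd w)<..<Sup (snd w)}" if "w \<in> P" for w
        proof -
          have "snd w = {Inf (snd w)..Sup (snd w)}"
            using ivl(1)[of "fst w" "snd w"] that by (simp add: P_def)
          then show ?thesis by (metis interior_atLeastAtMost_real)
        qed
        then show "{Inf (snd y)<..<Sup (snd y)} \<inter> {Inf (snd z)<..<Sup (snd z)} = {}"
          using tagged_division_ofD(5)[OF p, of "fst y" "snd y" "fst z" "snd z"] yz
          by (auto simp: P_def)
      qed
      have "a \<le> Inf (snd z) \<and> Inf (snd z) \<le> Sup (snd z) \<and> Sup (snd z) \<le> b" if "z \<in> P" for z
        using ivl(2-5)[of "fst z" "snd z"] that by (simp add: P_def)
      then show "\<forall>z\<in>P. a \<le> Inf (snd z) \<and> Inf (snd z) \<le> Sup (snd z) \<and> Sup (snd z) \<le> b"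
        by blast
    qed (simp add: P_def fin)
    then have inside: "- \<epsilon> \<le> (\<Sum>z\<in>P. ?\<Delta> z)"
      using norm_sum[of ?\<Delta> P] by (simp add: abs_le_iff)
    have len: "(\<Sum>z\<in>p - P. ?len z) \<le> b - a"
    proof -
      have "(\<Sum>z\<in>p - P. ?len z) \<le> (\<Sum>z\<in>p. ?len z)"
        using ivl(2,3) fin by (intro sum_mono2) (force simp: P_def)+
      also have "\<dots> = b - a"
        using additive_tagged_division_1[OF \<open>a \<le> b\<close> p, of "\<lambda>x. x"] by (simp add: split_def)
      finally show ?thesis .
    qed
    have "- \<epsilon> * (b - a) \<le> - \<epsilon> * (\<Sum>z\<in>p - P. ?len z)"
      using len \<epsilon> by simp
    also have "\<dots> = (\<Sum>z\<in>p - P. - \<epsilon> * ?len z)" by (simp add: sum_distrib_left)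
    also have "\<dots> \<le> (\<Sum>z\<in>p - P. ?\<Delta> z)"
    proof (rule sum_mono)
      fix z assume z: "z \<in> p - P"
      then have xK: "(fst z, snd z) \<in> p" "fst z \<notin> N" by (auto simp: P_def)
      have "Inf (snd z) \<in> snd z" "Sup (snd z) \<in> snd z"
        using ivl(1-3)[OF xK(1)] by (metis atLeastAtMost_iff order.trans order_refl)+
      then show "- \<epsilon> * ?len z \<le> ?\<Delta> z"
        using ivl(2-6)[OF xK(1)] xK(2) by (intro r[of "fst z"]) auto
    qed
    finally have "- \<epsilon> * (b - a) \<le> (\<Sum>z\<in>p - P. ?\<Delta> z)" .
    moreover have "(\<Sum>z\<in>p. ?\<Delta> z) = (\<Sum>z\<in>p - P. ?\<Delta> z) + (\<Sum>z\<in>P. ?\<Delta> z)"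
      using fin by (intro sum.subset_diff) (auto simp: P_def)
    moreover have "(\<Sum>z\<in>p. ?\<Delta> z) = f b - f a"
      using additive_tagged_division_1[OF \<open>a \<le> b\<close> p, of f] by (simp add: split_def)
    ultimately show ?thesis using inside by (simp add: algebra_simps)
  qed
  have "f a - f b \<le> e" if "e > 0" for e
    using key[of "e / (b - a + 1)"] that \<open>a \<le> b\<close> by simp
  then have "f a - f b \<le> 0" by (rule field_le_epsilon[of _ 0, simplified])
  then show ?thesis by simp
qed

text \<open>Subtracting \<open>c * t\<close> from the component along \<open>u\<close> leaves a
  scalar function with nonnegative derivative off \<open>N\<close>, which is nondecreasing. This
  mean value estimate yields both the drift along \<open>\<xi>\<close> and the speed bound, without
  integrating the derivative.\<close>

lemma absolutely_continuous_on_ivl_inner_ge: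
  fixes p :: "real \<Rightarrow> 'b::euclidean_space"
  assumes "a \<le> b" and ac: "absolutely_continuous_on_ivl a b p" and "negligible N"
    and der: "\<And>t. t \<in> {a..b} - N \<Longrightarrow>
                \<exists>v. (p has_vector_derivative v) (at t within {a..b}) \<and> c \<le> v \<bullet> u"
  shows "c * (b - a) \<le> (p b - p a) \<bullet> u"
proof -
  define f where "f t = p t \<bullet> u - c * t" for t
  have "absolutely_continuous_on_ivl a b f"
  proof (rule absolutely_continuous_on_ivl_dominated[OF ac])
    fix s t :: real assume "s \<le> t"
    have "f t - f s = (p t - p s) \<bullet> u - c * (t - s)" by (simp add: f_def algebra_simps)
    then have "norm (f t - f s) \<le> \<bar>(p t - p s) \<bullet> u\<bar> + \<bar>c * (t - s)\<bar>"
      by (metis abs_triangle_ineq4 real_norm_def)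
    also have "\<dots> \<le> norm u * norm (p t - p s) + \<bar>c\<bar> * (t - s)"
      using Cauchy_Schwarz_ineq2[of "p t - p s" u] \<open>s \<le> t\<close> by (simp add: abs_mult mult.commute)
    finally show "norm (f t - f s) \<le> norm u * norm (p t - p s) + \<bar>c\<bar> * (t - s)" .
  qed auto
  then have "f a \<le> f b"
  proof (rule absolutely_continuous_on_ivl_nondecreasing[OF \<open>a \<le> b\<close> _ \<open>negligible N\<close>])
    fix t assume "t \<in> {a..b} - N"
    then obtain v where v: "(p has_vector_derivative v) (at t within {a..b})" "c \<le> v \<bullet> u"
      using der by blast
    have "((\<lambda>t. p t \<bullet> u) has_vector_derivative v \<bullet> u) (at t within {a..b})"
      by (rule bounded_linear.has_vector_derivative[OF bounded_linear_inner_left v(1)])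
    then have "(f has_real_derivative v \<bullet> u - c) (at t within {a..b})"
      unfolding f_def has_real_derivative_iff_has_vector_derivative[symmetric]
      by (auto intro!: derivative_eq_intros)
    then show "\<exists>d\<ge>0. (f has_real_derivative d) (at t within {a..b})"
      using v(2) by (intro exI[of _ "v \<bullet> u - c"]) auto
  qed
  then show ?thesis by (simp add: f_def algebra_simps)
qed

text \<open>The component estimate is tested against the negative of the displacement itself:
  Cauchy-Schwarz bounds that component of the velocity below by \<open>- (M * norm u)\<close>, and a
  factor \<open>norm u\<close> cancels at the end.\<close>

lemma absolutely_continuous_on_ivl_norm_le:
  fixes p :: "real \<Rightarrow> 'b::euclidean_space"
  assumes "a \<le> b" and "absolutely_continuous_on_ivl a b p" and "negligible N"
    and der: "\<And>t. t \<in> {a..b} - N \<Longrightarrow>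
                \<exists>v. (p has_vector_derivative v) (at t within {a..b}) \<and> norm v \<le> M"
    and "M \<ge> 0"
  shows "norm (p b - p a) \<le> M * (b - a)"
proof -
  define u where "u = p b - p a"
  have "- (M * norm u) * (b - a) \<le> u \<bullet> (- u)"
    unfolding u_def
  proof (rule absolutely_continuous_on_ivl_inner_ge[OF assms(1-3)])
    fix t assume "t \<in> {a..b} - N"
    then obtain v where v: "(p has_vector_derivative v) (at t within {a..b})" "norm v \<le> M"
      using der by blast
    have "v \<bullet> u \<le> M * norm u"
      using norm_cauchy_schwarz[of v u] mult_right_mono[OF v(2), of "norm u"] by simp
    with v(1) show "\<exists>v. (p has_vector_derivative v) (at t within {a..b}) \<and>
        - (M * norm (p b - p a)) \<le> v \<bullet> - (p b - p a)"
      by (intro exI[of _ v]) (simp add: u_def inner_diff_right)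
  qed
  then have "norm u * norm u \<le> norm u * (M * (b - a))"
    by (simp add: dot_square_norm power2_eq_square algebra_simps)
  then show ?thesis
    using \<open>M \<ge> 0\<close> \<open>a \<le> b\<close> by (cases "u = 0") (simp_all add: u_def)
qed

section \<open>Hitting times\<close>

text \<open>The superlevel set \<open>S\<close> is compact, so it has a least element
  \<open>c\<close>. The intermediate value theorem gives a point of \<open>S\<close> up to
  \<open>c\<close> with value exactly \<open>d\<close>, and by minimality it is
  \<open>c\<close>.\<close>

lemma first_hitting_time:
  fixes g :: "real \<Rightarrow> real"
  assumes "continuous_on {a..b} g" "a \<le> b" "g a \<le> d" "d \<le> g b"
  obtains c where "c \<in> {a..b}" "g c = d" "\<And>t. t \<in> {a..c} \<Longrightarrow> g t \<le> d"
proof -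
  define S where "S = {t \<in> {a..b}. d \<le> g t}"
  have "closed ({a..b} \<inter> g -` {d..})"
    by (rule continuous_closed_preimage[OF assms(1)]) auto
  moreover have S_eq: "S = {a..b} \<inter> g -` {d..}" by (auto simp: S_def)
  moreover have "bounded S" by (rule bounded_subset[of "{a..b}"]) (auto simp: S_def)
  ultimately have "compact S" by (simp add: compact_eq_bounded_closed)
  moreover have "b \<in> S" using assms by (simp add: S_def)
  then have "S \<noteq> {}" by blast
  ultimately obtain c where c: "c \<in> S" "\<forall>t\<in>S. c \<le> t"
    using compact_attains_inf by metis
  then have c': "a \<le> c" "c \<le> b" "d \<le> g c" by (simp_all add: S_def)
  then have "continuous_on {a..c} g" by (intro continuous_on_subset[OF assms(1)]) simp
  from IVT'[OF \<open>g a \<le> d\<close> c'(3,1) this] obtain t where t: "a \<le> t" "t \<le> c" "g t = d" by blast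
  then have "t \<in> S" using c' by (simp add: S_def)
  then have "t = c" using c(2) t(2) by fastforce
  with t(3) have gc: "g c = d" by simp
  have "g s \<le> d" if s: "s \<in> {a..c}" for s
  proof (rule ccontr)
    assume "\<not> g s \<le> d"
    then have "s \<in> S" using s c' by (simp add: S_def)
    then have "s = c" using c(2) s by fastforce
    with gc \<open>\<not> g s \<le> d\<close> show False by simp
  qed
  with gc c' show thesis by (intro that[of c]) simp_all
qed

text \<open>This is the first hitting time after time reversal. It serves trajectories that end at
  the base point.\<close>

lemma last_hitting_time:
  fixes g :: "real \<Rightarrow> real"
  assumes "continuous_on {a..b} g" "a \<le> b" "d \<le> g a" "g b \<le> d"
  obtains c where "c \<in> {a..b}" "g c = d" "\<And>t. t \<in> {c..b} \<Longrightarrow> g t \<le> d"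
proof -
  have "continuous_on {- b..- a} uminus" by (intro continuous_intros)
  then have "continuous_on {- b..- a} (\<lambda>t. g (- t))"
    using continuous_on_compose[of "{- b..- a}" uminus g] assms(1) by (simp add: o_def)
  moreover have "- b \<le> - a" "g (- (- b)) \<le> d" "d \<le> g (- (- a))" using assms(2-4) by simp_all
  ultimately obtain c where c: "c \<in> {- b..- a}" "g (- c) = d"
      "\<And>t. t \<in> {- b..c} \<Longrightarrow> g (- t) \<le> d"
    by (rule first_hitting_time[of "- b" "- a" "\<lambda>t. g (- t)" d]) (rule that)
  show thesis
  proof (intro that[of "- c"])
    show "- c \<in> {a..b}" using c(1) by auto
    show "g t \<le> d" if "t \<in> {- c..b}" for t using c(3)[of "- t"] that by auto
  qed (rule c(2))
qed

section \<open>Trajectories near the base point\<close>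

text \<open>Trajectories only assert that some admissible derivative exists almost everywhere,
  whereas the cost evaluates \<open>vector_derivative\<close>. Uniqueness of derivatives identifies
  the two off one null set, so bounds on admissible velocities apply to the integrand.\<close>

lemma trajectories_derivative:
  assumes "(T, p) \<in> trajectories X F Obs y z"
  obtains N where "negligible N"
    "\<And>t. t \<in> {0..T} - N \<Longrightarrow>
       vector_derivative p (at t within {0..T}) \<in> F (p t) \<and>
       (p has_vector_derivative vector_derivative p (at t within {0..T})) (at t within {0..T})"
proof -
  have "AE t in lebesgue_on {0..T}. \<exists>v\<in>F (p t). (p has_vector_derivative v) (at t within {0..T})"
    using assms by (simp add: trajectories_def)
  then have "AE t in lebesgue. t \<in> {0..T} \<longrightarrow>
      (\<exists>v\<in>F (p t). (p has_vector_derivative v) (at t within {0..T}))"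
    by (simp add: AE_restrict_space_iff)
  then obtain N0 where N0: "N0 \<in> null_sets lebesgue"
    and der: "{t. \<not> (t \<in> {0..T} \<longrightarrow>
      (\<exists>v\<in>F (p t). (p has_vector_derivative v) (at t within {0..T})))} \<subseteq> N0"
    by (auto simp: eventually_ae_filter)
  \<comment> \<open>Removing \<open>0\<close> disposes of \<open>T = 0\<close>, where derivatives within \<open>{0..T}\<close> are not unique.\<close>
  show thesis
  proof (rule that[of "insert 0 N0"])
    show "negligible (insert 0 N0)" using N0 by (simp add: negligible_iff_null_sets negligible_insert)
    fix t assume t: "t \<in> {0..T} - insert 0 N0"
    then obtain v where v: "v \<in> F (p t)" "(p has_vector_derivative v) (at t within {0..T})"
      using der by blast
    moreover have "vector_derivative p (at t within {0..T}) = v"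
      using t v(2) by (intro vector_derivative_within_closed_interval) auto
    ultimately show "vector_derivative p (at t within {0..T}) \<in> F (p t) \<and>
       (p has_vector_derivative vector_derivative p (at t within {0..T})) (at t within {0..T})"
      by simp
  qed
qed

lemma AE_lebesgue_on_negligible:
  assumes "negligible N" "S \<in> sets lebesgue" "\<And>t. t \<in> S - N \<Longrightarrow> P t"
  shows "AE t in lebesgue_on S. P t"
proof -
  have "AE t in lebesgue. t \<notin> N"
    using assms(1) by (simp add: negligible_iff_null_sets AE_not_in)
  then have "AE t in lebesgue. t \<in> S \<longrightarrow> P t"
    by eventually_elim (use assms(3) in blast)
  then show ?thesis using assms(2) by (simp add: AE_restrict_space_iff)
qed

text \<open>The estimates on trajectories need only these constants; the locale separates them from
  the compactness and Lipschitz arguments that produce the constants.\<close>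

locale controlled_ball =
  fixes X :: "'a::euclidean_space set" and F :: "'a \<Rightarrow> 'a set" and Obs :: "'a set"
    and \<psi> :: "'a \<Rightarrow> 'a \<Rightarrow> real" and x \<xi> :: 'a and \<delta> M m C h :: real
  assumes pos: "\<delta> > 0" "M > 0" "m > 0" "C > 0" "h > 0"
    and bounds: "\<And>z v. z \<in> X \<Longrightarrow> z \<in> cball x \<delta> \<Longrightarrow> v \<in> F z \<Longrightarrow>
      norm v \<le> M \<and> m \<le> \<psi> z v \<and> \<psi> z v \<le> C \<and> h \<le> v \<bullet> \<xi>"
begin

text \<open>With speed at most \<open>M\<close>, the displacement over \<open>{a..b}\<close> forces
  a minimal duration, during which the running cost is at least \<open>m\<close>. Only this stretch
  has to lie in the ball.\<close>

lemma path_cost_ge: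
  assumes tr: "(T, p) \<in> trajectories X F Obs y z"
    and ab: "0 \<le> a" "a \<le> b" "b \<le> T"
    and near: "\<And>t. t \<in> {a..b} \<Longrightarrow> p t \<in> cball x \<delta>"
  shows "ennreal (m * (norm (p b - p a) / M)) \<le> path_cost \<psi> T p"
proof -
  obtain N where N: "negligible N" and der: "\<And>t. t \<in> {0..T} - N \<Longrightarrow>
       vector_derivative p (at t within {0..T}) \<in> F (p t) \<and>
       (p has_vector_derivative vector_derivative p (at t within {0..T})) (at t within {0..T})"
    using trajectories_derivative[OF tr] by metis
  have X: "p t \<in> X" if "t \<in> {0..T}" for t using tr that by (simp add: trajectories_def)
  have ac: "absolutely_continuous_on_ivl a b p"
    using tr ab absolutely_continuous_on_ivl_subset by (force simp: trajectories_def)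
  have "norm (p b - p a) \<le> M * (b - a)"
  proof (rule absolutely_continuous_on_ivl_norm_le[OF \<open>a \<le> b\<close> ac N])
    fix t assume "t \<in> {a..b} - N"
    then have t: "t \<in> {0..T} - N" "t \<in> {a..b}" using ab by auto
    have "(p has_vector_derivative vector_derivative p (at t within {0..T})) (at t within {a..b})"
      using der[OF t(1)] ab by (auto intro: has_vector_derivative_within_subset)
    then show "\<exists>v. (p has_vector_derivative v) (at t within {a..b}) \<and> norm v \<le> M"
      using bounds[of "p t"] der[OF t(1)] near[OF t(2)] X[of t] t by blast
  qed (use pos in simp)
  then have "norm (p b - p a) / M \<le> b - a"
    using pos by (simp add: field_simps)
  then have "ennreal (m * (norm (p b - p a) / M)) \<le> ennreal (m * (b - a))"
    using pos by (intro ennreal_leI mult_left_mono) auto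
  also have "\<dots> = ennreal m * emeasure (lebesgue_on {0..T}) {a..b}"
    using ab pos by (simp add: emeasure_restrict_space ennreal_mult)
  \<comment> \<open>Outside \<open>{a..b}\<close> the nonnegative integrand is bounded below by
    zero, which the indicator encodes.\<close>
  also have "\<dots> = (\<integral>\<^sup>+ t. ennreal m * indicator {a..b} t \<partial>lebesgue_on {0..T})"
    using ab by (subst nn_integral_cmult_indicator) (auto simp: sets_restrict_space_iff)
  also have "\<dots> \<le> path_cost \<psi> T p"
    unfolding path_cost_def
  proof (rule nn_integral_mono_AE, rule AE_lebesgue_on_negligible[OF N])
    fix t assume t: "t \<in> {0..T} - N"
    show "ennreal m * indicator {a..b} t \<le> ennreal (\<psi> (p t) (vector_derivative p (at t within {0..T})))"
      using bounds[of "p t" "vector_derivative p (at t within {0..T})"] near[of t] der[OF t] X[of t] t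
      by (auto simp: indicator_def intro!: ennreal_leI)
  qed auto
  finally show ?thesis .
qed

text \<open>Otherwise there is a stretch within the closed ball joining its centre to its boundary:
  up to the first hitting of distance \<open>\<delta>\<close> if the trajectory starts at
  \<open>x\<close>, from the last one if it ends there. That stretch alone costs
  \<open>m * (\<delta> / M)\<close>.\<close>

lemma cheap_trajectory_stays_near:
  assumes tr: "(T, p) \<in> trajectories X F Obs y z" and "y = x \<or> z = x"
    and cheap: "path_cost \<psi> T p < ennreal (m * (\<delta> / M))" and t: "t \<in> {0..T}"
  shows "p t \<in> cball x \<delta>"
proof (rule ccontr)
  assume far: "p t \<notin> cball x \<delta>"
  define g where "g s = dist x (p s)" for s
  have "continuous_on {0..T} p"
    using tr absolutely_continuous_on_ivl_imp_continuous_on by (auto simp: trajectories_def)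
  then have cont: "continuous_on {0..T} g"
    unfolding g_def by (intro continuous_intros)
  have "\<exists>a b. 0 \<le> a \<and> a \<le> b \<and> b \<le> T \<and> (\<forall>s\<in>{a..b}. g s \<le> \<delta>) \<and> norm (p b - p a) = \<delta>"
    using assms(2)
  proof
    assume "y = x"
    then have p0: "p 0 = x" using tr by (simp add: trajectories_def)
    obtain c where "c \<in> {0..t}" "g c = \<delta>" "\<And>s. s \<in> {0..c} \<Longrightarrow> g s \<le> \<delta>"
      using first_hitting_time[of 0 t g \<delta>] continuous_on_subset[OF cont, of "{0..t}"]
        far t pos p0 by (auto simp: g_def)
    then show ?thesis
      using t p0 by (intro exI[of _ 0] exI[of _ c]) (auto simp: g_def dist_norm norm_minus_commute)
  next
    assume "z = x"
    then have pT: "p T = x" using tr by (simp add: trajectories_def)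
    obtain c where "c \<in> {t..T}" "g c = \<delta>" "\<And>s. s \<in> {c..T} \<Longrightarrow> g s \<le> \<delta>"
      using last_hitting_time[of t T g \<delta>] continuous_on_subset[OF cont, of "{t..T}"]
        far t pos pT by (auto simp: g_def)
    then show ?thesis
      using t pT by (intro exI[of _ c] exI[of _ T]) (auto simp: g_def dist_norm)
  qed
  then obtain a b where "0 \<le> a" "a \<le> b" "b \<le> T" "\<forall>s\<in>{a..b}. g s \<le> \<delta>" "norm (p b - p a) = \<delta>"
    by blast
  with path_cost_ge[OF tr this(1-3)] cheap show False
    by (auto simp: g_def)
qed

lemma cheap_trajectory_displacement:
  assumes tr: "(T, p) \<in> trajectories X F Obs y z" and "y = x \<or> z = x"
    and cheap: "path_cost \<psi> T p < ennreal (m * (\<delta> / M))"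
    and "ennreal \<rho> \<le> path_cost \<psi> T p"
  shows "h * \<rho> / C \<le> norm (z - y) * norm \<xi>"
proof -
  have T: "0 \<le> T" and ends: "p 0 = y" "p T = z" and ac: "absolutely_continuous_on_ivl 0 T p"
    and X: "\<And>t. t \<in> {0..T} \<Longrightarrow> p t \<in> X"
    using tr by (auto simp: trajectories_def)
  obtain N where N: "negligible N" and der: "\<And>t. t \<in> {0..T} - N \<Longrightarrow>
       vector_derivative p (at t within {0..T}) \<in> F (p t) \<and>
       (p has_vector_derivative vector_derivative p (at t within {0..T})) (at t within {0..T})"
    using trajectories_derivative[OF tr] by metis
  note near = cheap_trajectory_stays_near[OF tr assms(2) cheap]
  have "path_cost \<psi> T p \<le> (\<integral>\<^sup>+ t. ennreal C \<partial>lebesgue_on {0..T})"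
    unfolding path_cost_def
  proof (rule nn_integral_mono_AE, rule AE_lebesgue_on_negligible[OF N])
    fix t assume t: "t \<in> {0..T} - N"
    show "ennreal (\<psi> (p t) (vector_derivative p (at t within {0..T}))) \<le> ennreal C"
      using bounds near der[OF t] X t by (intro ennreal_leI) blast
  qed auto
  also have "\<dots> = ennreal (C * T)"
    using T pos by (simp add: emeasure_restrict_space ennreal_mult)
  finally have "ennreal \<rho> \<le> ennreal (C * T)" using assms(4) by order
  then have "\<rho> \<le> C * T" using T pos by (simp add: ennreal_le_iff)
  then have "h * \<rho> / C \<le> h * (T - 0)" using pos by (simp add: field_simps)
  \<comment> \<open>The velocity always has component at least \<open>h\<close> along
    \<open>\<xi>\<close>, so the trajectory cannot turn back, and a long duration forces a large
    displacement.\<close>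
  also have "\<dots> \<le> (p T - p 0) \<bullet> \<xi>"
  proof (rule absolutely_continuous_on_ivl_inner_ge[OF T ac N])
    fix t assume "t \<in> {0..T} - N"
    then show "\<exists>v. (p has_vector_derivative v) (at t within {0..T}) \<and> h \<le> v \<bullet> \<xi>"
      using bounds near der X by blast
  qed
  also have "\<dots> \<le> norm (z - y) * norm \<xi>"
    using norm_cauchy_schwarz[of "p T - p 0" \<xi>] by (simp add: ends)
  finally show ?thesis .
qed

text \<open>The infimum need not be attained: a trajectory below the threshold suffices, since its
  cost still dominates the distance and hence \<open>\<rho>\<close>.\<close>

lemma cost_dist_separation:
  assumes "y = x \<or> z = x" and "cost_dist X F Obs \<psi> y z < ennreal (m * (\<delta> / M))"
    and "ennreal \<rho> \<le> cost_dist X F Obs \<psi> y z"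
  shows "h * \<rho> / C \<le> norm (z - y) * norm \<xi>"
proof -
  obtain T p where tr: "(T, p) \<in> trajectories X F Obs y z"
    and cheap: "path_cost \<psi> T p < ennreal (m * (\<delta> / M))"
    using assms(2) unfolding cost_dist_def INF_less_iff by auto
  have "cost_dist X F Obs \<psi> y z \<le> path_cost \<psi> T p"
    unfolding cost_dist_def using tr by (rule INF_lower2) simp
  with assms(3) have "ennreal \<rho> \<le> path_cost \<psi> T p" by (rule order.trans)
  then show ?thesis by (rule cheap_trajectory_displacement[OF tr assms(1) cheap])
qed

end

text \<open>Local boundedness gives \<open>M\<close>, extreme values of \<open>\<psi>\<close> on a
  compact set give \<open>m\<close> and \<open>C\<close>, and (SH3) keeps half of the Hamiltonian at
  \<open>x\<close> as a lower bound \<open>h\<close> nearby.\<close>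

lemma controlled_ball_exists:
  fixes X :: "'a::euclidean_space set"
  assumes "subspace X" and FX: "\<forall>z\<in>X. F z \<subseteq> X" and "SH1 X F" and "SH3 X F"
    and cont: "continuous_on (X \<times> X) (\<lambda>(z, v). \<psi> z v)"
    and \<psi>pos: "\<forall>z\<in>X. \<forall>v\<in>X. 0 < \<psi> z v"
    and "x \<in> X" and "\<xi> \<noteq> 0" and hpos: "min_hamiltonian F x \<xi> > 0"
  shows "\<exists>\<delta> M m C h. controlled_ball X F \<psi> x \<xi> \<delta> M m C h"
proof -
  define K where "K = X \<inter> cball x 1"
  have "closed X" using \<open>subspace X\<close> by (rule closed_subspace)
  then have K: "compact K" "K \<subseteq> X" "x \<in> K"
    using \<open>x \<in> X\<close> by (simp_all add: K_def closed_Int_compact)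
  then have "\<exists>M>0. \<forall>z\<in>K. \<forall>v\<in>F z. norm v \<le> M"
    using \<open>SH1 X F\<close> by (simp add: SH1_def)
  then obtain M where M: "M > 0" "\<And>z v. z \<in> K \<Longrightarrow> v \<in> F z \<Longrightarrow> norm v \<le> M"
    by blast
  have "\<exists>k>0. \<forall>y\<in>K. \<forall>z\<in>K.
      F y \<subseteq> {v + (k * norm (y - z)) *\<^sub>R b | v b. v \<in> F z \<and> b \<in> X \<inter> cball 0 1}"
    using \<open>SH3 X F\<close> K(1,2) unfolding SH3_def by (elim allE[of _ K] impE) (intro conjI)
  then obtain k where k: "k > 0" "\<And>y z. y \<in> K \<Longrightarrow> z \<in> K \<Longrightarrow>
      F y \<subseteq> {v + (k * norm (y - z)) *\<^sub>R b | v b. v \<in> F z \<and> b \<in> X \<inter> cball 0 1}"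
    by (elim exE conjE) (rule that, assumption, blast)
  \<comment> \<open>A compact set containing every pair of a point of \<open>K\<close> and an
    admissible velocity there; \<open>(x, 0)\<close> shows that it is nonempty.\<close>
  define L where "L = K \<times> (X \<inter> cball 0 M)"
  have L: "compact L" "L \<subseteq> X \<times> X" "(x, 0) \<in> L"
  proof -
    show "compact L"
      unfolding L_def using K(1) \<open>closed X\<close> by (simp add: compact_Times closed_Int_compact)
    show "L \<subseteq> X \<times> X" using K(2) by (auto simp: L_def)
    show "(x, 0) \<in> L" using K(3) M(1) subspace_0[OF \<open>subspace X\<close>] by (simp add: L_def)
  qed
  have contL: "continuous_on L (\<lambda>(z, v). \<psi> z v)"
    using cont L(2) by (rule continuous_on_subset)
  have "L \<noteq> {}" using L(3) by blast
  obtain l where l: "l \<in> L" "\<forall>q\<in>L. \<psi> (fst l) (snd l) \<le> \<psi> (fst q) (snd q)"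
    using continuous_attains_inf[OF L(1) \<open>L \<noteq> {}\<close> contL] by (auto simp: split_def)
  obtain c where c: "c \<in> L" "\<forall>q\<in>L. \<psi> (fst q) (snd q) \<le> \<psi> (fst c) (snd c)"
    using continuous_attains_sup[OF L(1) \<open>L \<noteq> {}\<close> contL] by (auto simp: split_def)
  define H where "H = min_hamiltonian F x \<xi>"
  have H: "H \<le> w \<bullet> \<xi>" if "w \<in> F x" for w
    unfolding H_def min_hamiltonian_def
  proof (rule cINF_lower[OF _ that])
    \<comment> \<open>A real infimum is a lower bound only for a set that is bounded below.\<close>
    have "- (M * norm \<xi>) \<le> w \<bullet> \<xi>" if "w \<in> F x" for w
      using Cauchy_Schwarz_ineq2[of w \<xi>] mult_right_mono[OF M(2)[OF K(3) that], of "norm \<xi>"]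
      by (auto simp: abs_le_iff)
    then show "bdd_below ((\<lambda>v. v \<bullet> \<xi>) ` F x)" by (rule bdd_belowI2)
  qed
  \<comment> \<open>The bound \<open>1\<close> keeps the ball inside \<open>K\<close>; the other
    makes the Lipschitz perturbation \<open>k * \<delta> * norm \<xi>\<close> at most
    \<open>H / 2\<close>.\<close>
  define \<delta> where "\<delta> = min 1 (H / (2 * k * norm \<xi>))"
  have "H > 0" using hpos by (simp add: H_def)
  have "\<delta> > 0" "\<delta> \<le> 1" using \<open>H > 0\<close> k(1) \<open>\<xi> \<noteq> 0\<close> by (auto simp: \<delta>_def)
  have "k * \<delta> * norm \<xi> \<le> k * (H / (2 * k * norm \<xi>)) * norm \<xi>"
    using k(1) by (intro mult_right_mono mult_left_mono) (auto simp: \<delta>_def)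
  then have kd: "k * \<delta> * norm \<xi> \<le> H / 2" using k(1) \<open>\<xi> \<noteq> 0\<close> by simp
  have "controlled_ball X F \<psi> x \<xi> \<delta> M (\<psi> (fst l) (snd l)) (\<psi> (fst c) (snd c)) (H / 2)"
  proof
    show "\<delta> > 0" "M > 0" "H / 2 > 0" by fact+ (use \<open>H > 0\<close> in simp)
    have "fst l \<in> X" "snd l \<in> X" "fst c \<in> X" "snd c \<in> X" using l(1) c(1) L(2) by auto
    then show "\<psi> (fst l) (snd l) > 0" "\<psi> (fst c) (snd c) > 0" using \<psi>pos by auto
    fix z v assume z: "z \<in> X" "z \<in> cball x \<delta>" and v: "v \<in> F z"
    have zK: "z \<in> K" using z \<open>\<delta> \<le> 1\<close> by (simp add: K_def)
    then have "(z, v) \<in> L" using M(2)[OF zK v] FX z(1) v by (auto simp: L_def)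
    moreover have "H / 2 \<le> v \<bullet> \<xi>"
    proof -
      obtain w b where w: "w \<in> F x" and b: "norm b \<le> 1"
        and v_eq: "v = w + (k * norm (z - x)) *\<^sub>R b"
        using k(2)[OF zK K(3)] v by auto
      have "\<bar>b \<bullet> \<xi>\<bar> \<le> norm \<xi>"
        using Cauchy_Schwarz_ineq2[of b \<xi>] mult_right_mono[OF b, of "norm \<xi>"] by simp
      then have "k * norm (z - x) * \<bar>b \<bullet> \<xi>\<bar> \<le> k * \<delta> * norm \<xi>"
        using z(2) k(1) \<open>\<delta> > 0\<close>
        by (intro mult_mono) (auto simp: dist_norm norm_minus_commute)
      then have "\<bar>k * norm (z - x) * (b \<bullet> \<xi>)\<bar> \<le> H / 2"
        using kd k(1) unfolding abs_mult by (metis abs_norm_cancel abs_of_pos order_trans)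
      moreover have "v \<bullet> \<xi> = w \<bullet> \<xi> + k * norm (z - x) * (b \<bullet> \<xi>)"
        by (simp add: v_eq inner_add_left)
      ultimately show ?thesis using H[OF w] by (simp add: abs_le_iff)
    qed
    ultimately show "norm v \<le> M \<and> \<psi> (fst l) (snd l) \<le> \<psi> z v \<and> \<psi> z v \<le> \<psi> (fst c) (snd c) \<and>
        H / 2 \<le> v \<bullet> \<xi>"
      using M(2)[OF zK v] l(2) c(2) by fastforce
  qed
  then show ?thesis by blast
qed

theorem lemma3p4:
  fixes X :: "'a::euclidean_space set"
    and F :: "'a \<Rightarrow> 'a set"
    and \<psi> :: "'a \<Rightarrow> 'a \<Rightarrow> real"
    and Obs :: "'a set"
    and x \<xi> :: 'a
  assumes "subspace X"
    and "\<forall>z\<in>X. F z \<subseteq> X"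
    and "SH1 X F" and "SH2 X F" and "SH3 X F"
    and "continuous_on (X \<times> X) (\<lambda>(z, v). \<psi> z v)"
    and "\<forall>z\<in>X. \<forall>v\<in>X. 0 < \<psi> z v"
    and "Obs \<subseteq> X" and "closed Obs"
    and "x \<in> X - Obs"
    and "\<xi> \<in> X" and "\<xi> \<noteq> 0"
    and "min_hamiltonian F x \<xi> > 0"
  shows "\<exists>\<rho>'>0. \<forall>\<rho>. 0 < \<rho> \<and> \<rho> < \<rho>' \<longrightarrow> (\<exists>r>0.
           cost_ball X F Obs \<psi> \<rho>' x - cost_ball X F Obs \<psi> \<rho> x \<subseteq> X - ball x r \<and>
           (\<forall>y\<in>X. ennreal \<rho> \<le> min (cost_dist X F Obs \<psi> x y) (cost_dist X F Obs \<psi> y x) \<and>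
                  min (cost_dist X F Obs \<psi> x y) (cost_dist X F Obs \<psi> y x) < ennreal \<rho>'
                  \<longrightarrow> norm (x - y) \<ge> r))"
proof -
  have "x \<in> X" using assms(10) by simp
  obtain \<delta> M m C h where "controlled_ball X F \<psi> x \<xi> \<delta> M m C h"
    using controlled_ball_exists[OF assms(1-3,5-7) \<open>x \<in> X\<close> assms(12,13)] by blast
  then interpret controlled_ball X F Obs \<psi> x \<xi> \<delta> M m C h .
  let ?\<rho>' = "m * (\<delta> / M)"
  let ?d = "\<lambda>y. min (cost_dist X F Obs \<psi> x y) (cost_dist X F Obs \<psi> y x)"
  show ?thesis
  proof (rule exI[of _ ?\<rho>'], intro conjI allI impI)
    show "?\<rho>' > 0" using pos by simp
    fix \<rho> assume \<rho>: "0 < \<rho> \<and> \<rho> < ?\<rho>'"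
    \<comment> \<open>The displacement estimate \<open>h * \<rho> / C\<close>, divided by
      \<open>norm \<xi>\<close>.\<close>
    define r where "r = h * \<rho> / (C * norm \<xi>)"
    have far: "r \<le> norm (x - y)" if "ennreal \<rho> \<le> ?d y" "?d y < ennreal ?\<rho>'" for y
    proof -
      have "h * \<rho> / C \<le> norm (x - y) * norm \<xi>"
        \<comment> \<open>One of the two distances is below the threshold, and like the minimum it
          is at least \<open>\<rho>\<close>. Separation then applies with \<open>x\<close> as start
          or as end.\<close>
        using that cost_dist_separation[of x y \<rho>] cost_dist_separation[of y x \<rho>]
        by (auto simp: min_less_iff_disj norm_minus_commute)
      then show ?thesis using pos \<open>\<xi> \<noteq> 0\<close> by (simp add: r_def field_simps)
    qed
    show "\<exists>r>0. cost_ball X F Obs \<psi> ?\<rho>' x - cost_ball X F Obs \<psi> \<rho> x \<subseteq> X - ball x r \<and>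
        (\<forall>y\<in>X. ennreal \<rho> \<le> ?d y \<and> ?d y < ennreal ?\<rho>' \<longrightarrow> norm (x - y) \<ge> r)"
    proof (intro exI[of _ r] conjI)
      show "r > 0" using \<rho> pos \<open>\<xi> \<noteq> 0\<close> by (simp add: r_def)
      show "cost_ball X F Obs \<psi> ?\<rho>' x - cost_ball X F Obs \<psi> \<rho> x \<subseteq> X - ball x r"
      proof
        fix y assume "y \<in> cost_ball X F Obs \<psi> ?\<rho>' x - cost_ball X F Obs \<psi> \<rho> x"
        then have "y \<in> X" "?d y < ennreal ?\<rho>'" "ennreal \<rho> \<le> ?d y"
          by (auto simp: cost_ball_def forward_reach_def backward_reach_def min_less_iff_disj)
        with far[of y] show "y \<in> X - ball x r" by (simp add: dist_norm)
      qed
      show "\<forall>y\<in>X. ennreal \<rho> \<le> ?d y \<and> ?d y < ennreal ?\<rho>' \<longrightarrow> norm (x - y) \<ge> r"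
        using far by blast
    qed
  qed
qed

end
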